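(* For all integers $k \ge 1$ and $n \ge 1$ and all $\epsilon \in (0,1/2)$: among all protocols $(f_1,\dots,f_k)$ with $f_i \in \mathcal{B}_n$, the unique best protocol up to $\pi_S$ for maximizing $$\mathbf{E}\bigl[\#\{(i,j) \in [k]\times[k] : f_i(y^i) = f_j(y^j)\}\bigr]$$ is given by $f_1 = \dots = f_k = f$, where $f(x) = x_1$. In particular, if $k = 2$ or $k = 3$, then for all $n$ and $\epsilon$ the unique best protocol up to $\pi_S$ for maximizing $\mathbf{P}[f_1(y^1) = \dots = f_k(y^k)]$ is given by $f_1 = \dots = f_k = f$, where $f(x) = x_1$.
   Context: Model: $x$ is uniform in $\{0,1\}^n$; $y^1,\dots,y^k \in \{0,1\}^n$ are random strings such that, given $x$, the events $\{y^i_j = x_j\}$ ($1\le i\le k$, $1\le j\le n$) are mutually independent, each of probability $1-\epsilon$. $\mathbf{P}$, $\mathbf{E}$ refer to this space. $\mathcal{B}_n$ is the set of balanced functions $f:\{0,1\}^n\to\{0,1\}$, i.e. $|f^{-1}(0)| = |f^{-1}(1)|$. A protocol is a tuple $(f_1,\dots,f_k)$ with each $f_i\in\mathcal{B}_n$. For $S\subseteq[n]$ and a permutation $\pi$ of $[n]$, $\pi_S:\{0,1\}^n\to\{0,1\}^n$ is defined by $\pi_S(x)_i = x_{\pi(i)}$ if $i\in S$ and $\pi_S(x)_i = 1-x_{\pi(i)}$ if $i\notin S$. For fixed $k,n,\epsilon$ and a given objective, $(f_1,\dots,f_k)$ is "the unique best protocol up to $\pi_S$" if the set of all protocols maximizing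 the objective is exactly $\{(f_1\circ\pi_S,\dots,f_k\circ\pi_S): S\subseteq[n],\ \pi \text{ a permutation of } [n]\}$.
   Formalization: For k = 1 and n ≥ 2 uniqueness fails (the objective is constantly 1, so e.g. x_1 XOR x_2 is also optimal); there only optimality of the protocols f∘π_S with f(x) = x_1 is claimed, and uniqueness for the expected number of agreeing pairs is stated when k ≥ 2 or n = 1. *)

theory Defs
  imports "HOL-Probability.Probability" "HOL-Combinatorics.Permutations"
begin

text \<open>Bits are Booleans (\<open>True\<close> is 1). Strings, functions on strings and protocols are extensional
  functions, so that equality of protocols is pointwise equality on the intended domain.\<close>

definition cube :: "nat \<Rightarrow> (nat \<Rightarrow> bool) set" where
  "cube n = {1..n} \<rightarrow>\<^sub>E UNIV"

definition balanced :: "nat \<Rightarrow> ((nat \<Rightarrow> bool) \<Rightarrow> bool) set" where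
  "balanced n = {f \<in> cube n \<rightarrow>\<^sub>E UNIV.
     card {x \<in> cube n. f x = False} = card {x \<in> cube n. f x = True}}"

definition protocols :: "nat \<Rightarrow> nat \<Rightarrow> (nat \<Rightarrow> (nat \<Rightarrow> bool) \<Rightarrow> bool) set" where
  "protocols k n = {1..k} \<rightarrow>\<^sub>E balanced n"

text \<open>The joint law of \<open>(x, y)\<close>, where \<open>y i\<close> is the string seen by party \<open>i\<close>. The bit \<open>a (i, j)\<close>
  is the indicator of the event \<open>y i j = x j\<close>; \<open>False\<close> is only the value of \<open>a\<close> outside the
  index set.\<close>

definition source :: "nat \<Rightarrow> nat \<Rightarrow> real \<Rightarrow> ((nat \<Rightarrow> bool) \<times> (nat \<Rightarrow> nat \<Rightarrow> bool)) pmf" where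
  "source k n \<epsilon> =
     bind_pmf (pmf_of_set (cube n)) (\<lambda>x.
     bind_pmf (Pi_pmf ({1..k} \<times> {1..n}) False (\<lambda>_. bernoulli_pmf (1 - \<epsilon>))) (\<lambda>a.
     return_pmf (x, \<lambda>i\<in>{1..k}. \<lambda>j\<in>{1..n}. if a (i, j) then x j else \<not> x j)))"

definition expected_agreements ::
    "nat \<Rightarrow> nat \<Rightarrow> real \<Rightarrow> (nat \<Rightarrow> (nat \<Rightarrow> bool) \<Rightarrow> bool) \<Rightarrow> real" where
  "expected_agreements k n \<epsilon> F =
     measure_pmf.expectation (source k n \<epsilon>)
       (\<lambda>(x, y). real (card {(i, j) \<in> {1..k} \<times> {1..k}. F i (y i) = F j (y j)}))"

definition prob_unanimous ::
    "nat \<Rightarrow> nat \<Rightarrow> real \<Rightarrow> (nat \<Rightarrow> (nat \<Rightarrow> bool) \<Rightarrow> bool) \<Rightarrow> real" where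
  "prob_unanimous k n \<epsilon> F =
     measure_pmf.prob (source k n \<epsilon>)
       {(x, y). \<forall>i\<in>{1..k}. \<forall>j\<in>{1..k}. F i (y i) = F j (y j)}"

definition perm_flip :: "nat \<Rightarrow> (nat \<Rightarrow> nat) \<Rightarrow> nat set \<Rightarrow> (nat \<Rightarrow> bool) \<Rightarrow> nat \<Rightarrow> bool" where
  "perm_flip n \<pi> S x = (\<lambda>i\<in>{1..n}. if i \<in> S then x (\<pi> i) else \<not> x (\<pi> i))"

definition perm_flip_orbit ::
    "nat \<Rightarrow> nat \<Rightarrow> (nat \<Rightarrow> (nat \<Rightarrow> bool) \<Rightarrow> bool) \<Rightarrow> (nat \<Rightarrow> (nat \<Rightarrow> bool) \<Rightarrow> bool) set" where
  "perm_flip_orbit k n F =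
     {(\<lambda>i\<in>{1..k}. \<lambda>x\<in>cube n. F i (perm_flip n \<pi> S x)) | S \<pi>. S \<subseteq> {1..n} \<and> \<pi> permutes {1..n}}"

definition best_protocols ::
    "nat \<Rightarrow> nat \<Rightarrow> ((nat \<Rightarrow> (nat \<Rightarrow> bool) \<Rightarrow> bool) \<Rightarrow> real) \<Rightarrow> (nat \<Rightarrow> (nat \<Rightarrow> bool) \<Rightarrow> bool) set" where
  "best_protocols k n obj = {F \<in> protocols k n. \<forall>G\<in>protocols k n. obj G \<le> obj F}"

definition unique_best_up_to_perm_flip ::
    "nat \<Rightarrow> nat \<Rightarrow> ((nat \<Rightarrow> (nat \<Rightarrow> bool) \<Rightarrow> bool) \<Rightarrow> real) \<Rightarrow> (nat \<Rightarrow> (nat \<Rightarrow> bool) \<Rightarrow> bool) \<Rightarrow> bool" where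
  "unique_best_up_to_perm_flip k n obj F \<longleftrightarrow> best_protocols k n obj = perm_flip_orbit k n F"

definition first_bit_protocol :: "nat \<Rightarrow> nat \<Rightarrow> nat \<Rightarrow> (nat \<Rightarrow> bool) \<Rightarrow> bool" where
  "first_bit_protocol k n = (\<lambda>i\<in>{1..k}. \<lambda>x\<in>cube n. x 1)"

text \<open>With a single party the number of agreeing pairs is always 1, so every balanced function is
  optimal, and for \<open>n \<ge> 2\<close> the exclusive or of the first two bits is optimal but is not in the
  orbit. Uniqueness can therefore only be claimed when \<open>k \<ge> 2\<close> or \<open>n = 1\<close>.\<close>

lemma not_unique_best_single_party:
  assumes n: "n \<ge> 2"
  shows "\<not> unique_best_up_to_perm_flip 1 n (expected_agreements 1 n \<epsilon>) (first_bit_protocol 1 n)"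
proof
  assume u: "unique_best_up_to_perm_flip 1 n (expected_agreements 1 n \<epsilon>) (first_bit_protocol 1 n)"
  define f :: "(nat \<Rightarrow> bool) \<Rightarrow> bool" where "f = (\<lambda>x\<in>cube n. x 1 \<noteq> x 2)"
  define F where "F = (\<lambda>i\<in>{1..1::nat}. f)"
  have const: "expected_agreements 1 n \<epsilon> G = 1" for G
  proof -
    have "{(i, j). (i = Suc 0 \<and> j = Suc 0) \<and> G i (y i) = G j (y j)} = {(Suc 0, Suc 0)}"
      for y :: "nat \<Rightarrow> nat \<Rightarrow> bool"
      by auto
    then show ?thesis
      by (simp add: expected_agreements_def) (simp add: case_prod_unfold)
  qed
  have flip: "x(1 := \<not> x 1) \<in> cube n" "f (x(1 := \<not> x 1)) = (\<not> f x)" if "x \<in> cube n" for x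
  proof -
    show c: "x(1 := \<not> x 1) \<in> cube n"
      using that n by (simp add: cube_def PiE_iff extensional_def)
    show "f (x(1 := \<not> x 1)) = (\<not> f x)"
      unfolding f_def using that c by simp
  qed
  have "bij_betw (\<lambda>x. x(1 := \<not> x 1)) {x \<in> cube n. f x = False} {x \<in> cube n. f x = True}"
    by (rule bij_betwI[where g = "\<lambda>x. x(1 := \<not> x 1)"]) (use flip in \<open>simp_all add: Pi_iff\<close>)
  then have "card {x \<in> cube n. f x = False} = card {x \<in> cube n. f x = True}"
    by (rule bij_betw_same_card)
  moreover have "f \<in> cube n \<rightarrow>\<^sub>E UNIV"
    by (simp add: f_def)
  ultimately have "f \<in> balanced n"
    unfolding balanced_def by blast
  then have "F \<in> protocols 1 n"
    by (auto simp: F_def protocols_def)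
  then have "F \<in> best_protocols 1 n (expected_agreements 1 n \<epsilon>)"
    unfolding best_protocols_def const by blast
  then have "F \<in> perm_flip_orbit 1 n (first_bit_protocol 1 n)"
    using u unfolding unique_best_up_to_perm_flip_def by blast
  then obtain S \<pi> where p: "\<pi> permutes {1..n}" and
    eq: "F = (\<lambda>i\<in>{1..1}. \<lambda>x\<in>cube n. first_bit_protocol 1 n i (perm_flip n \<pi> S x))"
    unfolding perm_flip_orbit_def by blast
  have fx: "(x 1 \<noteq> x 2) = (if 1 \<in> S then x (\<pi> 1) else \<not> x (\<pi> 1))" if "x \<in> cube n" for x
  proof -
    have "perm_flip n \<pi> S x \<in> cube n"
      by (auto simp: perm_flip_def cube_def)
    then have "(x 1 \<noteq> x 2) = perm_flip n \<pi> S x 1"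
      using fun_cong[OF fun_cong[OF eq, of 1], of x] that
      by (simp add: F_def f_def first_bit_protocol_def)
    then show ?thesis
      using n by (simp add: perm_flip_def)
  qed
  define z where "z A = (\<lambda>i\<in>{1..n}. i \<in> A)" for A
  have z: "z A \<in> cube n" for A
    by (auto simp: z_def cube_def)
  have m: "\<pi> 1 \<in> {1..n}"
    using n permutes_in_image[OF p, of 1] by simp
  have zfx: "((1 \<in> A) \<noteq> (2 \<in> A)) = (if 1 \<in> S then \<pi> 1 \<in> A else \<pi> 1 \<notin> A)" for A
    using fx[OF z[of A]] m n by (simp add: z_def)
  have S: "1 \<in> S"
    using zfx[of "{}"] by (simp split: if_splits)
  have "\<pi> 1 = 1" "\<pi> 1 = 2"
    using zfx[of "{1}"] zfx[of "{2}"] S by simp_all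
  then show False
    by simp
qed

end

theory Submission
  imports Defs
begin

text \<open>
  Write the outputs as signs \<open>\<plusminus>1\<close> and expand them in characters. For \<open>i \<noteq> j\<close> the correlation of the two
  outputs is \<open>\<Sum>S. r ^ card S * (c\<^sub>i S * c\<^sub>j S)\<close> with \<open>r = (1 - 2\<epsilon>)\<^sup>2 \<in> (0, 1)\<close>
  and \<open>c\<^sub>i\<close> the Fourier coefficients of \<open>f\<^sub>i\<close>. Balancedness kills the term
  \<open>S = {}\<close>, so by Parseval the correlation is at most \<open>r\<close>, and equality forces \<open>f\<^sub>i = f\<^sub>j\<close> with all
  Fourier weight on singletons. Flipping one bit of such a function changes its value by \<open>\<plusminus>2\<close> times a
  Fourier coefficient, so the coefficients are in \<open>{-1, 0, 1}\<close> and exactly one of them is nonzero: the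
  function is a dictator or its negation. For two or three parties the number of agreeing pairs is
  an affine function of the indicator of unanimity.
\<close>

definition sg :: "bool \<Rightarrow> real" where
  "sg b = (if b then 1 else - 1)"

text \<open>The Walsh character (parity function) of \<open>S\<close>.\<close>

definition chi :: "nat set \<Rightarrow> (nat \<Rightarrow> bool) \<Rightarrow> real" where
  "chi S x = (\<Prod>j\<in>S. sg (x j))"

definition fourier :: "nat \<Rightarrow> ((nat \<Rightarrow> bool) \<Rightarrow> bool) \<Rightarrow> nat set \<Rightarrow> real" where
  "fourier n f S = (\<Sum>x\<in>cube n. sg (f x) * chi S x) / 2 ^ n"

text \<open>\<open>b = False\<close> gives the negated coordinate; the restriction to
  \<open>cube n\<close> makes the function extensional, as \<open>balanced n\<close>
  demands.\<close>

definition dictator :: "nat \<Rightarrow> nat \<Rightarrow> bool \<Rightarrow> (nat \<Rightarrow> bool) \<Rightarrow> bool" where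
  "dictator n m b = (\<lambda>x\<in>cube n. x m = b)"

declare One_nat_def [simp del]

section \<open>Fourier analysis on the cube\<close>

lemma sg_simps [simp]: "sg True = 1" "sg False = - 1" "sg b * sg b = 1" "sg (\<not> b) = - sg b"
  by (simp_all add: sg_def)

lemma sg_eq [simp]: "sg (a = b) = sg a * sg b"
  by (simp add: sg_def)

lemma sg_inject [simp]: "sg a = sg b \<longleftrightarrow> a = b"
  by (simp add: sg_def)

lemma sg_cases: "sg b = 1 \<or> sg b = - 1"
  by (simp add: sg_def)

lemma finite_cube [simp]: "finite (cube n)"
  by (auto simp: cube_def intro!: finite_PiE)

lemma card_cube: "card (cube n) = 2 ^ n"
  by (simp add: cube_def card_PiE)

lemma cube_nonempty [simp]: "cube n \<noteq> {}"
  by (simp add: cube_def PiE_eq_empty_iff)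

lemma cube_flip: "x \<in> cube n \<Longrightarrow> j \<in> {1..n} \<Longrightarrow> x(j := b) \<in> cube n"
  by (auto simp: cube_def PiE_iff extensional_def)

text \<open>Characters are products over coordinates, so the sum over the cube factorises; a
  coordinate in exactly one of the two sets contributes \<open>1 + (- 1) = 0\<close>.\<close>

lemma sum_cube_chi_mult:
  assumes "S \<subseteq> {1..n}" "T \<subseteq> {1..n}"
  shows "(\<Sum>x\<in>cube n. chi S x * chi T x) = (if S = T then 2 ^ n else 0)"
proof -
  \<comment> \<open>Padding with factors 1 lets both products run over \<open>{1..n}\<close>, as the
    exchange of sum and product requires.\<close>
  define u where "u S j b = (if j \<in> S then sg b else 1)" for S and j :: nat and b
  have chi: "chi S x = (\<Prod>j\<in>{1..n}. u S j (x j))" if "S \<subseteq> {1..n}" for S x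
    unfolding chi_def u_def using that
    by (intro prod.mono_neutral_cong_left) auto
  have "(\<Sum>x\<in>cube n. chi S x * chi T x) =
        (\<Sum>x\<in>cube n. \<Prod>j\<in>{1..n}. u S j (x j) * u T j (x j))"
    by (simp add: chi assms prod.distrib)
  also have "\<dots> = (\<Prod>j\<in>{1..n}. \<Sum>b\<in>UNIV. u S j b * u T j b)"
    unfolding cube_def by (rule prod_sum_PiE [symmetric]) auto
  also have "\<dots> = (\<Prod>j\<in>{1..n}. if j \<in> S \<longleftrightarrow> j \<in> T then 2 else 0)"
    by (intro prod.cong) (auto simp: u_def UNIV_bool)
  also have "\<dots> = (if S = T then 2 ^ n else 0)"
  proof (cases "S = T")
    case False
    then obtain j where "j \<in> {1..n}" "(j \<in> S) \<noteq> (j \<in> T)"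
      using assms by blast
    then show ?thesis
      using False by (intro trans[OF prod_zero]) auto
  qed simp
  finally show ?thesis .
qed

text \<open>The sum over sets is the expansion of
  \<open>\<Prod>j\<in>{1..n}. sg (x j) * sg (y j) + 1\<close>, in which a coordinate where
  \<open>x\<close> and \<open>y\<close> differ gives a factor 0.\<close>

lemma sum_Pow_chi_mult:
  assumes "x \<in> cube n" "y \<in> cube n"
  shows "(\<Sum>S\<in>Pow {1..n}. chi S x * chi S y) = (if x = y then 2 ^ n else 0)"
proof -
  have "(\<Sum>S\<in>Pow {1..n}. chi S x * chi S y) = (\<Prod>j\<in>{1..n}. sg (x j) * sg (y j) + 1)"
    by (simp add: prod_add chi_def prod.distrib)
  also have "\<dots> = (\<Prod>j\<in>{1..n}. if x j = y j then 2 else 0)"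
    by (intro prod.cong) (auto simp: sg_def)
  also have "\<dots> = (if x = y then 2 ^ n else 0)"
  proof (cases "x = y")
    case False
    then obtain j where "j \<in> {1..n}" "x j \<noteq> y j"
      using assms PiE_ext[of x "{1..n}" "\<lambda>_. UNIV" y] unfolding cube_def by blast
    then show ?thesis
      using False by (intro trans[OF prod_zero]) auto
  qed simp
  finally show ?thesis .
qed

text \<open>After the sums are exchanged, the dual orthogonality \<open>sum_Pow_chi_mult\<close>
  leaves only the term \<open>y = x\<close>.\<close>

lemma fourier_inversion:
  assumes "x \<in> cube n"
  shows "sg (f x) = (\<Sum>S\<in>Pow {1..n}. fourier n f S * chi S x)"
proof -
  have "(\<Sum>S\<in>Pow {1..n}. fourier n f S * chi S x) =
        (\<Sum>S\<in>Pow {1..n}. \<Sum>y\<in>cube n. sg (f y) * (chi S y * chi S x)) / 2 ^ n"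
    by (simp add: fourier_def sum_distrib_right sum_divide_distrib mult.assoc)
  also have "\<dots> = (\<Sum>y\<in>cube n. sg (f y) * (\<Sum>S\<in>Pow {1..n}. chi S y * chi S x)) / 2 ^ n"
    by (subst sum.swap) (simp add: sum_distrib_left)
  also have "\<dots> = (\<Sum>y\<in>cube n. if y = x then sg (f y) * 2 ^ n else 0) / 2 ^ n"
    by (intro arg_cong2[where f = "(/)"] sum.cong refl) (simp add: sum_Pow_chi_mult assms)
  also have "\<dots> = sg (f x)"
    using assms by simp
  finally show ?thesis ..
qed

text \<open>Expanding one factor of each square by definition and summing over \<open>S\<close>
  first turns the other into \<open>sg (f x)\<close> by inversion; signs square to 1.\<close>

lemma parseval: "(\<Sum>S\<in>Pow {1..n}. (fourier n f S)\<^sup>2) = 1"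
proof -
  have "(\<Sum>S\<in>Pow {1..n}. (fourier n f S)\<^sup>2) =
        (\<Sum>S\<in>Pow {1..n}. \<Sum>x\<in>cube n. sg (f x) * (fourier n f S * chi S x)) / 2 ^ n"
    by (simp add: power2_eq_square sum_divide_distrib)
       (simp add: fourier_def[of n f] sum_distrib_left sum_distrib_right sum_divide_distrib ac_simps)
  also have "\<dots> = (\<Sum>x\<in>cube n. sg (f x) * (\<Sum>S\<in>Pow {1..n}. fourier n f S * chi S x)) / 2 ^ n"
    by (subst sum.swap) (simp add: sum_distrib_left)
  also have "\<dots> = (\<Sum>x\<in>cube n. sg (f x) * sg (f x)) / 2 ^ n"
    by (simp add: fourier_inversion[symmetric])
  also have "\<dots> = 1"
    by (simp add: card_cube)
  finally show ?thesis .
qed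

text \<open>The coefficient at \<open>{}\<close> is the difference of the two fibre sizes divided by
  \<open>2 ^ n\<close>.\<close>

lemma balanced_iff:
  "f \<in> balanced n \<longleftrightarrow> f \<in> cube n \<rightarrow>\<^sub>E UNIV \<and> fourier n f {} = 0"
proof -
  have "(\<Sum>x\<in>cube n. sg (f x)) =
        (\<Sum>x\<in>{x \<in> cube n. f x = True}. 1) + (\<Sum>x\<in>{x \<in> cube n. f x = False}. - 1)"
    by (simp add: sg_def sum.If_cases Collect_conj_eq Compl_eq)
  then show ?thesis
    by (auto simp: balanced_def fourier_def chi_def)
qed

lemma fourier_inject:
  assumes "f \<in> balanced n" "g \<in> balanced n" "\<And>S. S \<subseteq> {1..n} \<Longrightarrow> fourier n f S = fourier n g S"
  shows "f = g"
proof (rule PiE_ext)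
  show "f \<in> cube n \<rightarrow>\<^sub>E UNIV" "g \<in> cube n \<rightarrow>\<^sub>E UNIV"
    using assms by (auto simp: balanced_iff)
  fix x assume "x \<in> cube n"
  then have "sg (f x) = sg (g x)"
    using assms(3) by (simp add: fourier_inversion)
  then show "f x = g x"
    by simp
qed

section \<open>Dictators and their spectrum\<close>

lemma fourier_dictator:
  assumes "m \<in> {1..n}" "S \<subseteq> {1..n}"
  shows "fourier n (dictator n m b) S = (if S = {m} then sg b else 0)"
proof -
  have "fourier n (dictator n m b) S = sg b * (\<Sum>x\<in>cube n. chi {m} x * chi S x) / 2 ^ n"
    by (simp add: fourier_def dictator_def chi_def sum_distrib_left ac_simps)
  also have "(\<Sum>x\<in>cube n. chi {m} x * chi S x) = (if {m} = S then 2 ^ n else 0)"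
    by (rule sum_cube_chi_mult) (use assms in auto)
  finally show ?thesis
    by auto
qed

lemma dictator_balanced: "m \<in> {1..n} \<Longrightarrow> dictator n m b \<in> balanced n"
  by (simp add: balanced_iff fourier_dictator) (simp add: dictator_def)

lemma dictatorI:
  assumes f: "f \<in> balanced n"
    and level1: "\<And>S. S \<subseteq> {1..n} \<Longrightarrow> card S \<ge> 2 \<Longrightarrow> fourier n f S = 0"
  obtains m b where "m \<in> {1..n}" "f = dictator n m b"
proof -
  define c where "c j = fourier n f {j}" for j
  \<comment> \<open>Sums controlled by the Fourier coefficients live on singletons: balancedness
    kills the empty set, \<open>level1\<close> every larger set. This serves both inversion and
    Parseval.\<close>
  have level1_sum: "(\<Sum>S\<in>Pow {1..n}. h S) = (\<Sum>j\<in>{1..n}. h {j})"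
    if "\<And>S. fourier n f S = 0 \<Longrightarrow> h S = 0" for h :: "nat set \<Rightarrow> real"
  proof -
    have "h S = 0" if "S \<in> Pow {1..n} - (\<lambda>j. {j}) ` {1..n}" for S
    proof -
      have "card S \<noteq> 1"
        using that by (auto elim!: card_1_singletonE)
      moreover have "finite S"
        using that finite_subset[of S "{1..n}"] by simp
      ultimately have "S = {} \<or> card S \<ge> 2"
        by (cases "card S = 0") (simp, linarith)
      then have "fourier n f S = 0"
        using level1 that f by (auto simp: balanced_iff)
      then show ?thesis
        using \<open>\<And>S. fourier n f S = 0 \<Longrightarrow> h S = 0\<close> by blast
    qed
    then have "(\<Sum>S\<in>Pow {1..n}. h S) = (\<Sum>S\<in>(\<lambda>j. {j}) ` {1..n}. h S)"
      by (intro sum.mono_neutral_right) auto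
    also have "\<dots> = (\<Sum>j\<in>{1..n}. h {j})"
      by (subst sum.reindex) auto
    finally show ?thesis .
  qed
  have lin: "sg (f x) = (\<Sum>j\<in>{1..n}. c j * sg (x j))" if "x \<in> cube n" for x
    using that by (simp add: fourier_inversion level1_sum) (simp add: c_def chi_def)
  have square: "(\<Sum>j\<in>{1..n}. (c j)\<^sup>2) = 1"
    using parseval[of n f] by (simp add: level1_sum c_def)
  have "(c j)\<^sup>2 = 0 \<or> (c j)\<^sup>2 = 1" if j: "j \<in> {1..n}" for j
  proof -
    obtain x where x: "x \<in> cube n"
      using cube_nonempty by blast
    have eq: "sg (f (x(j := b))) = c j * sg b + (\<Sum>i\<in>{1..n} - {j}. c i * sg (x i))" for b
      using lin[OF cube_flip[OF x j, of b]] j by (simp add: sum.remove[of _ j])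
    \<comment> \<open>Flipping bit \<open>j\<close> moves the linear form by \<open>2 * c j\<close>,
      while two signs differ by 0, 2 or -2.\<close>
    have "sg (f (x(j := True))) - sg (f (x(j := False))) = 2 * c j"
      by (simp add: eq)
    then have "c j = 0 \<or> c j = 1 \<or> c j = - 1"
      using sg_cases[of "f (x(j := True))"] sg_cases[of "f (x(j := False))"] by auto
    then show ?thesis
      by auto
  qed
  moreover obtain m where m: "m \<in> {1..n}" "c m \<noteq> 0"
    using square by (metis (mono_tags, lifting) sum.neutral zero_neq_one zero_power2)
  ultimately have cm: "(c m)\<^sup>2 = 1"
    by fastforce
  \<comment> \<open>The square of \<open>c m\<close> already exhausts the Parseval sum, so all other
    coefficients vanish.\<close>
  have "(\<Sum>j\<in>{1..n} - {m}. (c j)\<^sup>2) = 0"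
    using square m cm by (simp add: sum.remove[of _ m])
  then have c0: "c j = 0" if "j \<in> {1..n} - {m}" for j
    using that by (subst (asm) sum_nonneg_eq_0_iff) auto
  have f_eq: "sg (f x) = c m * sg (x m)" if "x \<in> cube n" for x
    using lin[OF that] m c0 by (simp add: sum.remove[of _ m])
  define b where "b = (c m = 1)"
  have "c m = sg b"
    using cm by (auto simp: b_def power2_eq_1_iff)
  have "f = dictator n m b"
  proof (rule PiE_ext)
    show "f \<in> cube n \<rightarrow>\<^sub>E UNIV" "dictator n m b \<in> cube n \<rightarrow>\<^sub>E UNIV"
      using f by (auto simp: balanced_iff dictator_def)
    fix x assume x: "x \<in> cube n"
    then have "sg (f x) = sg (x m = b)"
      using f_eq \<open>c m = sg b\<close> by simp
    then show "f x = dictator n m b x"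
      using x unfolding sg_inject dictator_def by simp
  qed
  with m(1) that show ?thesis
    by blast
qed

section \<open>Correlation of two balanced functions under noise\<close>

text \<open>The inner product of \<open>f\<close> and \<open>g\<close> after the noise operator that
  scales the character of \<open>S\<close> by \<open>r ^ card S\<close>; with independent noise in
  both copies, \<open>r\<close> will be \<open>(1 - 2 * \<epsilon>)\<^sup>2\<close>.\<close>

definition noisy_corr :: "nat \<Rightarrow> real \<Rightarrow> ((nat \<Rightarrow> bool) \<Rightarrow> bool) \<Rightarrow> ((nat \<Rightarrow> bool) \<Rightarrow> bool) \<Rightarrow> real" where
  "noisy_corr n r f g = (\<Sum>S\<in>Pow {1..n}. r ^ card S * (fourier n f S * fourier n g S))"

text \<open>Both summands are nonnegative for \<open>0 < r < 1\<close>: the first one penalises weight on large sets, the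
  second one penalises \<open>f \<noteq> g\<close>.\<close>

lemma noisy_corr_defect:
  assumes "f \<in> balanced n" "g \<in> balanced n"
  shows "r - noisy_corr n r f g = (\<Sum>S\<in>Pow {1..n} - {{}}.
    (r - r ^ card S) * (((fourier n f S)\<^sup>2 + (fourier n g S)\<^sup>2) / 2) +
    r ^ card S * ((fourier n f S - fourier n g S)\<^sup>2 / 2))"
proof -
  \<comment> \<open>Parseval spreads \<open>r\<close> over all sets, half through \<open>f\<close>
    and half through \<open>g\<close>.\<close>
  have "r = r / 2 * (\<Sum>S\<in>Pow {1..n}. (fourier n f S)\<^sup>2) + r / 2 * (\<Sum>S\<in>Pow {1..n}. (fourier n g S)\<^sup>2)"
    by (simp add: parseval)
  then have "r - noisy_corr n r f g = (\<Sum>S\<in>Pow {1..n}. r / 2 * (fourier n f S)\<^sup>2 +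
      r / 2 * (fourier n g S)\<^sup>2 - r ^ card S * (fourier n f S * fourier n g S))"
    by (simp add: noisy_corr_def sum_subtractf sum.distrib sum_distrib_left)
  \<comment> \<open>The empty set is removed before regrouping: its term is zero, but there
    \<open>r - r ^ card S\<close> would be negative for \<open>r < 1\<close>.\<close>
  also have "\<dots> = (\<Sum>S\<in>Pow {1..n} - {{}}. r / 2 * (fourier n f S)\<^sup>2 +
      r / 2 * (fourier n g S)\<^sup>2 - r ^ card S * (fourier n f S * fourier n g S))"
    using assms by (intro sum.mono_neutral_right) (auto simp: balanced_iff)
  also have "\<dots> = (\<Sum>S\<in>Pow {1..n} - {{}}.
    (r - r ^ card S) * (((fourier n f S)\<^sup>2 + (fourier n g S)\<^sup>2) / 2) +
    r ^ card S * ((fourier n f S - fourier n g S)\<^sup>2 / 2))"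
    \<comment> \<open>Uses \<open>a * b = (a\<^sup>2 + b\<^sup>2) / 2 - (a - b)\<^sup>2 / 2\<close>
      for the two coefficients.\<close>
    by (intro sum.cong refl) (simp add: field_simps power2_eq_square)
  finally show ?thesis .
qed

lemma noisy_corr_defect_term_nonneg:
  fixes r a b :: real and n :: nat
  assumes "0 < r" "r < 1" "S \<in> Pow {1..n} - {{}}"
  shows "0 \<le> (r - r ^ card S) * ((a\<^sup>2 + b\<^sup>2) / 2) + r ^ card S * ((a - b)\<^sup>2 / 2)"
proof -
  have "finite S"
    using assms(3) finite_subset[of S "{1..n}"] by simp
  then have "card S \<ge> 1"
    using assms card_gt_0_iff[of S] by simp
  then have "r ^ card S \<le> r ^ 1"
    using assms by (intro power_decreasing) auto
  then show ?thesis
    using assms by simp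
qed

lemma noisy_corr_le:
  assumes "0 < r" "r < 1" "f \<in> balanced n" "g \<in> balanced n"
  shows "noisy_corr n r f g \<le> r"
proof -
  have "r - noisy_corr n r f g \<ge> 0"
    unfolding noisy_corr_defect[OF assms(3,4)]
    by (rule sum_nonneg) (rule noisy_corr_defect_term_nonneg[OF assms(1,2)])
  then show ?thesis
    by simp
qed

text \<open>A vanishing defect makes both nonnegative summands vanish at every nonempty
  \<open>S\<close>: \<open>r ^ card S > 0\<close> gives equal coefficients, and
  \<open>r ^ card S < r\<close> for \<open>card S \<ge> 2\<close> leaves only singletons, so
  \<open>dictatorI\<close> applies.\<close>

lemma noisy_corr_eqD:
  assumes r: "0 < r" "r < 1" and "f \<in> balanced n" "g \<in> balanced n" and eq: "noisy_corr n r f g = r"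
  shows "f = g" "\<exists>m\<in>{1..n}. \<exists>b. f = dictator n m b"
proof -
  have "(\<Sum>S\<in>Pow {1..n} - {{}}.
    (r - r ^ card S) * (((fourier n f S)\<^sup>2 + (fourier n g S)\<^sup>2) / 2) +
    r ^ card S * ((fourier n f S - fourier n g S)\<^sup>2 / 2)) = 0"
    unfolding noisy_corr_defect[OF assms(3,4), symmetric] eq by simp
  then have zero: "(r - r ^ card S) * (((fourier n f S)\<^sup>2 + (fourier n g S)\<^sup>2) / 2) +
      r ^ card S * ((fourier n f S - fourier n g S)\<^sup>2 / 2) = 0" if "S \<in> Pow {1..n} - {{}}" for S
    using that noisy_corr_defect_term_nonneg[OF r] by (subst (asm) sum_nonneg_eq_0_iff) auto
  have pos: "fourier n f S = fourier n g S" "card S \<ge> 2 \<Longrightarrow> fourier n f S = 0"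
    if S: "S \<in> Pow {1..n} - {{}}" for S
  proof -
    have "finite S"
      using S finite_subset[of S "{1..n}"] by simp
    then have "card S \<ge> 1"
      using S card_gt_0_iff[of S] by simp
    then have "r ^ card S \<le> r ^ 1"
      using r by (intro power_decreasing) auto
    then have "(r - r ^ card S) * (((fourier n f S)\<^sup>2 + (fourier n g S)\<^sup>2) / 2) \<ge> 0"
      "r ^ card S * ((fourier n f S - fourier n g S)\<^sup>2 / 2) \<ge> 0"
      using r by simp_all
    with zero[OF S] have z: "(r - r ^ card S) * (((fourier n f S)\<^sup>2 + (fourier n g S)\<^sup>2) / 2) = 0"
      "r ^ card S * ((fourier n f S - fourier n g S)\<^sup>2 / 2) = 0"
      by linarith+
    show "fourier n f S = fourier n g S"
      using z(2) r by simp
    assume "card S \<ge> 2"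
    then have "r ^ card S < r ^ 1"
      using r by (intro power_strict_decreasing) auto
    then show "fourier n f S = 0"
      using z(1) by (simp add: sum_power2_eq_zero_iff)
  qed
  show "f = g"
  proof (rule fourier_inject)
    \<comment> \<open>The defect says nothing about \<open>{}\<close>; there both coefficients are 0
      by balancedness.\<close>
    fix S assume "S \<subseteq> {1..n}"
    then show "fourier n f S = fourier n g S"
      using pos(1) assms(3,4) by (cases "S = {}") (auto simp: balanced_iff)
  qed fact+
  have "fourier n f S = 0" if "S \<subseteq> {1..n}" "card S \<ge> 2" for S
    using pos(2)[of S] that by (cases "S = {}") auto
  then show "\<exists>m\<in>{1..n}. \<exists>b. f = dictator n m b"
    by (metis dictatorI assms(3))
qed

lemma noisy_corr_dictator:
  assumes "m \<in> {1..n}"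
  shows "noisy_corr n r (dictator n m b) (dictator n m b) = r"
proof -
  have "noisy_corr n r (dictator n m b) (dictator n m b) =
        (\<Sum>S\<in>Pow {1..n}. if S = {m} then r else 0)"
    unfolding noisy_corr_def
    by (intro sum.cong) (simp_all add: fourier_dictator[OF assms(1)] assms)
  then show ?thesis
    using assms by simp
qed

section \<open>The source\<close>

text \<open>Coordinates of a product distribution are independent; finite supports settle
  integrability. Taking a subset \<open>U\<close> fits characters, which involve only some of the
  noise bits.\<close>

lemma expectation_prod_Pi_pmf_subset:
  fixes f :: "'a \<Rightarrow> 'b \<Rightarrow> real"
  assumes "finite A" "U \<subseteq> A" "\<And>x. x \<in> A \<Longrightarrow> finite (set_pmf (p x))"
  shows "measure_pmf.expectation (Pi_pmf A d p) (\<lambda>a. \<Prod>x\<in>U. f x (a x)) =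
         (\<Prod>x\<in>U. measure_pmf.expectation (p x) (f x))"
proof -
  let ?M = "measure_pmf (Pi_pmf A d p)"
  let ?E = "measure_pmf.expectation (Pi_pmf A d p)"
  have "finite U"
    using assms finite_subset by blast
  have "finite (set_pmf (Pi_pmf A d p))"
    using assms by (auto simp: set_Pi_pmf intro!: finite_PiE_dflt)
  then have int: "integrable ?M h" for h :: "_ \<Rightarrow> real"
    by (rule integrable_measure_pmf_finite)
  have "prob_space.indep_vars ?M (\<lambda>_. count_space UNIV) (\<lambda>x a. a x) U"
    by (rule prob_space.indep_vars_subset[OF measure_pmf.prob_space_axioms indep_vars_Pi_pmf[OF assms(1)] assms(2)])
  then have "prob_space.indep_vars ?M (\<lambda>_. borel) (\<lambda>x a. f x (a x)) U"
    by (rule prob_space.indep_vars_compose2[OF measure_pmf.prob_space_axioms]) simp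
  then have "?E (\<lambda>a. \<Prod>x\<in>U. f x (a x)) = (\<Prod>x\<in>U. ?E (\<lambda>a. f x (a x)))"
    using \<open>finite U\<close> int by (intro prob_space.indep_vars_lebesgue_integral[OF measure_pmf.prob_space_axioms])
  also have "\<dots> = (\<Prod>x\<in>U. measure_pmf.expectation (p x) (f x))"
  proof (rule prod.cong)
    fix x assume "x \<in> U"
    then have "map_pmf (\<lambda>a. a x) (Pi_pmf A d p) = p x"
      using assms by (subst Pi_pmf_component) auto
    then show "?E (\<lambda>a. f x (a x)) = measure_pmf.expectation (p x) (f x)"
      by (metis integral_map_pmf)
  qed simp
  finally show ?thesis .
qed

text \<open>Isolates the deterministic part of \<open>source\<close>, so that for fixed
  \<open>x\<close> only the noise \<open>a\<close> is random.\<close>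

definition noisy_copies :: "nat \<Rightarrow> nat \<Rightarrow> (nat \<Rightarrow> bool) \<Rightarrow> (nat \<times> nat \<Rightarrow> bool) \<Rightarrow> nat \<Rightarrow> nat \<Rightarrow> bool" where
  "noisy_copies k n x a = (\<lambda>i\<in>{1..k}. \<lambda>j\<in>{1..n}. if a (i, j) then x j else \<not> x j)"

lemma source_altdef:
  "source k n \<epsilon> = bind_pmf (pmf_of_set (cube n)) (\<lambda>x. map_pmf (\<lambda>a. (x, noisy_copies k n x a))
     (Pi_pmf ({1..k} \<times> {1..n}) False (\<lambda>_. bernoulli_pmf (1 - \<epsilon>))))"
  unfolding source_def noisy_copies_def map_pmf_def ..

lemma finite_set_noise:
  "finite (set_pmf (Pi_pmf ({1..k} \<times> {1..n}) False (\<lambda>_::nat \<times> nat. bernoulli_pmf p)))"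
  by (auto simp: set_Pi_pmf intro!: finite_PiE_dflt)

lemma integrable_source: "integrable (source k n \<epsilon>) (h :: _ \<Rightarrow> real)"
  by (rule integrable_measure_pmf_finite) (auto simp: source_altdef finite_set_noise)

lemma source_copy_in_cube: "(x, y) \<in> set_pmf (source k n \<epsilon>) \<Longrightarrow> i \<in> {1..k} \<Longrightarrow> y i \<in> cube n"
  by (auto simp: source_altdef noisy_copies_def cube_def)

text \<open>A noisy bit has sign \<open>sg (x j) * sg (a (i, j))\<close>. Indexing the noise by
  \<open>{i} \<times> S\<close> makes the noise bits of different parties visibly disjoint.\<close>

lemma chi_noisy_copies:
  assumes "i \<in> {1..k}" "S \<subseteq> {1..n}"
  shows "chi S (noisy_copies k n x a i) = chi S x * (\<Prod>p\<in>{i} \<times> S. sg (a p))"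
proof -
  have "chi S (noisy_copies k n x a i) = (\<Prod>j\<in>S. sg (x j) * sg (a (i, j)))"
    unfolding chi_def using assms by (intro prod.cong) (auto simp: noisy_copies_def)
  moreover have "(\<Prod>p\<in>{i} \<times> S. sg (a p)) = (\<Prod>j\<in>S. sg (a (i, j)))"
    by (intro prod.reindex_bij_witness[where i = "Pair i" and j = snd]) auto
  ultimately show ?thesis
    by (simp add: prod.distrib chi_def)
qed

text \<open>Distinct parties use disjoint sets of noise bits, so all signs involved are independent,
  each of mean \<open>(1 - \<epsilon>) - \<epsilon>\<close>; averaging over \<open>x\<close> then
  brings in the orthogonality of characters.\<close>

lemma expectation_chi_chi:
  assumes i: "i \<in> {1..k}" "j \<in> {1..k}" "i \<noteq> j"
    and S: "S \<subseteq> {1..n}" "T \<subseteq> {1..n}" and \<epsilon>: "0 \<le> \<epsilon>" "\<epsilon> \<le> 1"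
  shows "measure_pmf.expectation (source k n \<epsilon>) (\<lambda>(x, y). chi S (y i) * chi T (y j)) =
         (if S = T then ((1 - 2 * \<epsilon>)\<^sup>2) ^ card S else 0)"
proof -
  let ?N = "Pi_pmf ({1..k} \<times> {1..n}) False (\<lambda>_. bernoulli_pmf (1 - \<epsilon>))"
  let ?U = "{i} \<times> S \<union> {j} \<times> T"
  have fin: "finite S" "finite T"
    using S finite_subset by auto
  have disj: "({i} \<times> S) \<inter> ({j} \<times> T) = {}"
    using i by auto
  have "measure_pmf.expectation ?N (\<lambda>a. \<Prod>p\<in>?U. sg (a p)) = (\<Prod>p\<in>?U. 1 - 2 * \<epsilon>)"
    using i S \<epsilon> by (subst expectation_prod_Pi_pmf_subset) auto
  also have "\<dots> = (1 - 2 * \<epsilon>) ^ (card S + card T)"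
    using disj fin by (simp add: card_Un_disjoint card_cartesian_product)
  finally have noise: "measure_pmf.expectation ?N (\<lambda>a. \<Prod>p\<in>?U. sg (a p)) =
    (1 - 2 * \<epsilon>) ^ (card S + card T)" .
  have "measure_pmf.expectation (source k n \<epsilon>) (\<lambda>(x, y). chi S (y i) * chi T (y j)) =
    (\<Sum>x\<in>cube n. measure_pmf.expectation ?N
       (\<lambda>a. chi S (noisy_copies k n x a i) * chi T (noisy_copies k n x a j)) /\<^sub>R 2 ^ n)"
    unfolding source_altdef
    by (subst pmf_expectation_bind_pmf_of_set) (simp_all add: finite_set_noise card_cube)
  also have "\<dots> = (\<Sum>x\<in>cube n. measure_pmf.expectation ?N
       (\<lambda>a. (chi S x * chi T x) * (\<Prod>p\<in>?U. sg (a p))) /\<^sub>R 2 ^ n)"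
    using disj fin
    by (simp only: chi_noisy_copies i S prod.union_disjoint finite_cartesian_product finite.intros
        ac_simps)
  also have "\<dots> = (\<Sum>x\<in>cube n. chi S x * chi T x) * (1 - 2 * \<epsilon>) ^ (card S + card T) / 2 ^ n"
    by (simp add: noise sum_distrib_right sum_distrib_left divide_inverse_commute)
  \<comment> \<open>For \<open>S = T\<close> the exponent is \<open>2 * card S\<close>, whence the
    square.\<close>
  also have "\<dots> = (if S = T then ((1 - 2 * \<epsilon>)\<^sup>2) ^ card S else 0)"
    by (simp add: sum_cube_chi_mult S power_mult flip: mult_2)
  finally show ?thesis .
qed

lemma expectation_sg_sg:
  assumes i: "i \<in> {1..k}" "j \<in> {1..k}" "i \<noteq> j" and \<epsilon>: "0 \<le> \<epsilon>" "\<epsilon> \<le> 1"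
  shows "measure_pmf.expectation (source k n \<epsilon>) (\<lambda>(x, y). sg (f (y i)) * sg (g (y j))) =
         noisy_corr n ((1 - 2 * \<epsilon>)\<^sup>2) f g"
proof -
  let ?E = "measure_pmf.expectation (source k n \<epsilon>)"
  have "?E (\<lambda>(x, y). sg (f (y i)) * sg (g (y j))) =
    ?E (\<lambda>z. \<Sum>S\<in>Pow {1..n}. \<Sum>T\<in>Pow {1..n}. fourier n f S * fourier n g T *
         (case z of (x, y) \<Rightarrow> chi S (y i) * chi T (y j)))"
  \<comment> \<open>Inversion is available only on the cube, so the integrands are compared on the
    support of the source.\<close>
  proof (rule integral_cong_AE)
    show "AE z in source k n \<epsilon>. (case z of (x, y) \<Rightarrow> sg (f (y i)) * sg (g (y j))) =
      (\<Sum>S\<in>Pow {1..n}. \<Sum>T\<in>Pow {1..n}. fourier n f S * fourier n g T *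
         (case z of (x, y) \<Rightarrow> chi S (y i) * chi T (y j)))"
      unfolding AE_measure_pmf_iff
    proof (clarify, goal_cases)
      case (1 x y)
      then have "y i \<in> cube n" "y j \<in> cube n"
        using source_copy_in_cube i by blast+
      then show ?case
        by (simp add: fourier_inversion sum_product ac_simps)
    qed
  qed simp_all
  also have "\<dots> = (\<Sum>S\<in>Pow {1..n}. \<Sum>T\<in>Pow {1..n}. fourier n f S * fourier n g T *
         ?E (\<lambda>(x, y). chi S (y i) * chi T (y j)))"
    by (simp add: integrable_source)
  also have "\<dots> = (\<Sum>S\<in>Pow {1..n}. \<Sum>T\<in>Pow {1..n}.
      if T = S then ((1 - 2 * \<epsilon>)\<^sup>2) ^ card S * (fourier n f S * fourier n g T) else 0)"
    using assms by (intro sum.cong refl) (simp add: expectation_chi_chi)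
  also have "\<dots> = noisy_corr n ((1 - 2 * \<epsilon>)\<^sup>2) f g"
    unfolding noisy_corr_def by (intro sum.cong refl) simp
  finally show ?thesis .
qed

section \<open>The objectives in terms of pairwise correlations\<close>

lemma card_pairs:
  assumes "finite A"
  shows "real (card {(i, j) \<in> A \<times> A. P i j}) = (\<Sum>i\<in>A. \<Sum>j\<in>A. if P i j then 1 else 0)"
proof -
  have "{(i, j) \<in> A \<times> A. P i j} = Sigma A (\<lambda>i. {j \<in> A. P i j})"
    by auto
  then show ?thesis
    using assms by (simp add: sum.If_cases Int_def)
qed

text \<open>The indicator of agreement is half of one plus the product of the two signs; a diagonal
  pair always agrees, which amounts to correlation 1.\<close>

lemma expected_agreements_eq:
  assumes "0 \<le> \<epsilon>" "\<epsilon> \<le> 1"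
  shows "expected_agreements k n \<epsilon> F = (\<Sum>(i, j)\<in>{1..k} \<times> {1..k}.
    (1 + (if i = j then 1 else noisy_corr n ((1 - 2 * \<epsilon>)\<^sup>2) (F i) (F j))) / 2)"
proof -
  let ?E = "measure_pmf.expectation (source k n \<epsilon>)"
  have card: "real (card {(i, j) \<in> {1..k} \<times> {1..k}. F i (y i) = F j (y j)}) =
    (\<Sum>p\<in>{1..k} \<times> {1..k}. (1 + sg (F (fst p) (y (fst p))) * sg (F (snd p) (y (snd p)))) / 2)"
    for y :: "nat \<Rightarrow> nat \<Rightarrow> bool"
    unfolding card_pairs[OF finite_atLeastAtMost] sum.cartesian_product
    by (intro sum.cong) (auto simp: sg_def)
  have "expected_agreements k n \<epsilon> F = (\<Sum>p\<in>{1..k} \<times> {1..k}.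
      (1 + ?E (\<lambda>(x, y). sg (F (fst p) (y (fst p))) * sg (F (snd p) (y (snd p))))) / 2)"
    unfolding expected_agreements_def card
    by (simp add: case_prod_unfold integrable_source)
  also have "\<dots> = (\<Sum>(i, j)\<in>{1..k} \<times> {1..k}.
      (1 + (if i = j then 1 else noisy_corr n ((1 - 2 * \<epsilon>)\<^sup>2) (F i) (F j))) / 2)"
    by (intro sum.cong refl) (auto simp: expectation_sg_sg[unfolded case_prod_unfold] assms case_prod_unfold)
  finally show ?thesis .
qed

text \<open>Two disagreeing outputs leave the 2 diagonal pairs, unanimity gives all 4.\<close>

lemma expected_agreements_two:
  "expected_agreements 2 n \<epsilon> F = 2 + 2 * prob_unanimous 2 n \<epsilon> F"
proof -
  let ?A = "{(x, y). \<forall>i\<in>{1..2}. \<forall>j\<in>{1..2}. F i (y i) = F j (y j)} :: ((nat \<Rightarrow> bool) \<times> (nat \<Rightarrow> nat \<Rightarrow> bool)) set"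
  have I: "{1..2::nat} = {1, 2}"
    by auto
  have "(\<lambda>(x, y). real (card {(i, j) \<in> {1..2} \<times> {1..2}. F i (y i) = F j (y j)})) =
    (\<lambda>z. 2 + 2 * indicator ?A z)"
    unfolding card_pairs[OF finite_atLeastAtMost] unfolding I by (rule ext) auto
  then show ?thesis
    unfolding expected_agreements_def prob_unanimous_def
    by (simp only:) (simp add: integrable_source)
qed

text \<open>Among three bits that are not all equal exactly two coincide, so there are
  \<open>3 + 2 = 5\<close> agreeing ordered pairs, against 9 under unanimity. With four parties the
  splits 2-2 and 3-1 already give different counts.\<close>

lemma expected_agreements_three:
  "expected_agreements 3 n \<epsilon> F = 5 + 4 * prob_unanimous 3 n \<epsilon> F"
proof -
  let ?A = "{(x, y). \<forall>i\<in>{1..3}. \<forall>j\<in>{1..3}. F i (y i) = F j (y j)} :: ((nat \<Rightarrow> bool) \<times> (nat \<Rightarrow> nat \<Rightarrow> bool)) set"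
  have I: "{1..3::nat} = {1, 2, 3}"
    by auto
  have "(\<lambda>(x, y). real (card {(i, j) \<in> {1..3} \<times> {1..3}. F i (y i) = F j (y j)})) =
    (\<lambda>z. 5 + 4 * indicator ?A z)"
    unfolding card_pairs[OF finite_atLeastAtMost] unfolding I by (rule ext) auto
  then show ?thesis
    unfolding expected_agreements_def prob_unanimous_def
    by (simp only:) (simp add: integrable_source)
qed

section \<open>Optimal protocols\<close>

lemma perm_flip_orbit_first_bit:
  assumes "n \<ge> 1"
  shows "perm_flip_orbit k n (first_bit_protocol k n) =
    {(\<lambda>i\<in>{1..k}. dictator n m b) | m b. m \<in> {1..n}}"
proof -
  \<comment> \<open>The first bit of the transformed string depends only on \<open>\<pi> 1\<close>
    and on whether \<open>1 \<in> S\<close>.\<close>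
  have eq: "(\<lambda>i\<in>{1..k}. \<lambda>x\<in>cube n. first_bit_protocol k n i (perm_flip n \<pi> S x)) =
    (\<lambda>i\<in>{1..k}. dictator n (\<pi> 1) (1 \<in> S))" for \<pi> S
  proof -
    have "perm_flip n \<pi> S x \<in> cube n" for x
      by (auto simp: perm_flip_def cube_def)
    then show ?thesis
      using assms by (auto simp: fun_eq_iff first_bit_protocol_def dictator_def perm_flip_def)
  qed
  show ?thesis
  proof (intro equalityI subsetI)
    fix F assume "F \<in> perm_flip_orbit k n (first_bit_protocol k n)"
    then obtain S \<pi> where "\<pi> permutes {1..n}" 
      "F = (\<lambda>i\<in>{1..k}. \<lambda>x\<in>cube n. first_bit_protocol k n i (perm_flip n \<pi> S x))"
      unfolding perm_flip_orbit_def by blast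
    moreover from this have "\<pi> 1 \<in> {1..n}"
      using assms permutes_in_image[of \<pi> "{1..n}" 1] by simp
    ultimately show "F \<in> {(\<lambda>i\<in>{1..k}. dictator n m b) | m b. m \<in> {1..n}}"
      unfolding eq by blast
  next
    fix F assume "F \<in> {(\<lambda>i\<in>{1..k}. dictator n m b) | m b. m \<in> {1..n}}"
    then obtain m b where m: "m \<in> {1..n}" and F: "F = (\<lambda>i\<in>{1..k}. dictator n m b)"
      by blast
    \<comment> \<open>Any permutation sending 1 to \<open>m\<close> would do, and \<open>S\<close>
      only has to decide the sign at 1.\<close>
    define S :: "nat set" where "S = (if b then {1} else {})"
    have "Transposition.transpose 1 m permutes {1..n}" "S \<subseteq> {1..n}"
      using assms m by (auto simp: S_def intro!: permutes_swap_id)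
    moreover have "F = (\<lambda>i\<in>{1..k}. dictator n (Transposition.transpose 1 m 1) (1 \<in> S))"
      by (simp add: F S_def)
    ultimately show "F \<in> perm_flip_orbit k n (first_bit_protocol k n)"
      unfolding perm_flip_orbit_def eq
      by (intro CollectI exI[of _ S] exI[of _ "Transposition.transpose 1 m"] conjI)
  qed
qed

text \<open>The comparison is made pair by pair: the diagonal terms coincide, and off the diagonal
  the dictator attains the upper bound \<open>r\<close>. Equal sums therefore force equality in each
  term.\<close>

lemma expected_agreements_le_dictator:
  fixes F G :: "nat \<Rightarrow> (nat \<Rightarrow> bool) \<Rightarrow> bool" and b :: bool
  assumes \<epsilon>: "0 < \<epsilon>" "\<epsilon> < 1/2" and F: "F \<in> protocols k n"
    and m: "m \<in> {1..n}"
  defines "G \<equiv> (\<lambda>i\<in>{1..k}. dictator n m b)" and "r \<equiv> (1 - 2 * \<epsilon>)\<^sup>2"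
  shows "expected_agreements k n \<epsilon> F \<le> expected_agreements k n \<epsilon> G"
    and "expected_agreements k n \<epsilon> F = expected_agreements k n \<epsilon> G \<Longrightarrow>
         i \<in> {1..k} \<Longrightarrow> j \<in> {1..k} \<Longrightarrow> i \<noteq> j \<Longrightarrow> noisy_corr n r (F i) (F j) = r"
proof -
  have r: "0 < r" "r < 1"
    using \<epsilon> by (auto simp: r_def power_less_one_iff abs_square_less_1)
  have Fi: "F i \<in> balanced n" if "i \<in> {1..k}" for i
    using F that by (auto simp: protocols_def)
  define t where "t H p = (1 + (if fst p = snd p then 1 else noisy_corr n r (H (fst p)) (H (snd p)))) / 2"
    for H :: "nat \<Rightarrow> (nat \<Rightarrow> bool) \<Rightarrow> bool" and p
  have obj: "expected_agreements k n \<epsilon> H = (\<Sum>p\<in>{1..k} \<times> {1..k}. t H p)" for H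
    unfolding t_def r_def using \<epsilon> by (intro expected_agreements_eq[unfolded case_prod_unfold]) auto
  have tG: "t G p = (1 + (if fst p = snd p then 1 else r)) / 2" if "p \<in> {1..k} \<times> {1..k}" for p
    using that m by (auto simp: t_def G_def noisy_corr_dictator)
  have le: "t F p \<le> t G p" if "p \<in> {1..k} \<times> {1..k}" for p
    using that noisy_corr_le[OF r Fi Fi] by (auto simp: tG) (auto simp: t_def)
  show "expected_agreements k n \<epsilon> F \<le> expected_agreements k n \<epsilon> G"
    unfolding obj by (intro sum_mono le)
  assume eq: "expected_agreements k n \<epsilon> F = expected_agreements k n \<epsilon> G"
    and ij: "i \<in> {1..k}" "j \<in> {1..k}" "i \<noteq> j"
  have "t F (i, j) = t G (i, j)"
    by (rule sum_mono_inv[OF eq[unfolded obj] le]) (use ij in auto)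
  then show "noisy_corr n r (F i) (F j) = r"
    using ij by (simp add: tG) (simp add: t_def)
qed

text \<open>Every dictator protocol attains the common upper bound. For the converse, a second party
  allows the equality case to be invoked; a single party is covered only for \<open>n = 1\<close>,
  where every balanced function is a dictator.\<close>

lemma best_protocols_expected_agreements:
  fixes k n :: nat and \<epsilon> :: real
  assumes "n \<ge> 1" "0 < \<epsilon>" "\<epsilon> < 1/2"
  defines "D \<equiv> {(\<lambda>i\<in>{1..k}. dictator n m b) | m b. m \<in> {1..n}}"
  shows "D \<subseteq> best_protocols k n (expected_agreements k n \<epsilon>)"
    and "k \<ge> 2 \<or> k = 1 \<and> n = 1 \<Longrightarrow> best_protocols k n (expected_agreements k n \<epsilon>) = D"
proof -
  have in_protocols: "(\<lambda>i\<in>{1..k}. dictator n m b) \<in> protocols k n" if "m \<in> {1..n}" for m b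
    using dictator_balanced[OF that] by (auto simp: protocols_def)
  show sub: "D \<subseteq> best_protocols k n (expected_agreements k n \<epsilon>)"
    using expected_agreements_le_dictator(1)[OF assms(2,3)] in_protocols
    by (auto simp: D_def best_protocols_def)
  define r where "r = (1 - 2 * \<epsilon>)\<^sup>2"
  have r: "0 < r" "r < 1"
    using assms(2,3) by (auto simp: r_def power_less_one_iff abs_square_less_1)
  assume k: "k \<ge> 2 \<or> k = 1 \<and> n = 1"
  have "F \<in> D" if "F \<in> best_protocols k n (expected_agreements k n \<epsilon>)" for F
  proof -
    \<comment> \<open>Any member of \<open>D\<close> could serve as reference, since an optimal
      protocol must match its value.\<close>
    let ?G = "\<lambda>i\<in>{1..k}. dictator n 1 True"
    have one: "1 \<in> {1..n}" "1 \<in> {1..k}"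
      using assms(1) k by auto
    have F: "F \<in> protocols k n"
      and best: "expected_agreements k n \<epsilon> ?G \<le> expected_agreements k n \<epsilon> F"
      using that in_protocols[OF one(1)] by (auto simp: best_protocols_def)
    have eq: "expected_agreements k n \<epsilon> F = expected_agreements k n \<epsilon> ?G"
      using best expected_agreements_le_dictator(1)[OF assms(2,3) F one(1)] by (rule antisym[rotated])
    have Fi: "F i \<in> balanced n" if "i \<in> {1..k}" for i
      using F that by (auto simp: protocols_def)
    note corr = expected_agreements_le_dictator(2)[OF assms(2,3) F one(1) eq, folded r_def]
    have "\<exists>m\<in>{1..n}. \<exists>b. F 1 = dictator n m b"
    proof (cases "k \<ge> 2")
      case True
      then have two: "2 \<in> {1..k}"
        by simp
      show ?thesis
        by (rule noisy_corr_eqD(2)[OF r Fi[OF one(2)] Fi[OF two] corr[OF one(2) two]]) simp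
    next
      case False
      with k have "n = 1"
        by simp
      \<comment> \<open>With one coordinate no set has two elements, so the level condition of
        \<open>dictatorI\<close> is vacuous.\<close>
      then have "fourier n (F 1) S = 0" if "S \<subseteq> {1..n}" "card S \<ge> 2" for S
        using card_mono[OF _ that(1)] that(2) by simp
      then show ?thesis
        by (metis dictatorI Fi[OF one(2)])
    qed
    then obtain m b where m: "m \<in> {1..n}" and F1: "F 1 = dictator n m b"
      by blast
    \<comment> \<open>Party 1 is the common partner: equality in each pair \<open>(i, 1)\<close>
      identifies the functions.\<close>
    have "F i = F 1" if "i \<in> {1..k}" for i
    proof (cases "i = 1")
      case False
      then show ?thesis
        by (rule noisy_corr_eqD(1)[OF r Fi[OF that] Fi[OF one(2)] corr[OF that one(2)]])
    qed simp
    then have "F = (\<lambda>i\<in>{1..k}. dictator n m b)"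
      using F F1 by (auto simp: fun_eq_iff protocols_def PiE_iff extensional_def)
    with m show ?thesis
      unfolding D_def by blast
  qed
  with sub show "best_protocols k n (expected_agreements k n \<epsilon>) = D"
    by blast
qed

text \<open>Carries optimality from expected agreements over to unanimity for two and three
  parties.\<close>

lemma best_protocols_affine:
  assumes "\<And>F. obj F = a + c * obj' F" "c > 0"
  shows "best_protocols k n obj = best_protocols k n obj'"
  using assms by (simp add: best_protocols_def)

theorem theorem1p3:
  fixes k n :: nat and \<epsilon> :: real
  assumes "k \<ge> 1" and "n \<ge> 1" and "0 < \<epsilon>" and "\<epsilon> < 1/2"
  shows "perm_flip_orbit k n (first_bit_protocol k n)
           \<subseteq> best_protocols k n (expected_agreements k n \<epsilon>)
    \<and> (k \<ge> 2 \<or> n = 1 \<longrightarrow>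
           unique_best_up_to_perm_flip k n (expected_agreements k n \<epsilon>) (first_bit_protocol k n))
    \<and> (k = 2 \<or> k = 3 \<longrightarrow>
           unique_best_up_to_perm_flip k n (prob_unanimous k n \<epsilon>) (first_bit_protocol k n))"
proof -
  note best = best_protocols_expected_agreements[OF assms(2-4), of k,
      folded perm_flip_orbit_first_bit[OF assms(2)]]
  have "best_protocols k n (prob_unanimous k n \<epsilon>) = best_protocols k n (expected_agreements k n \<epsilon>)"
    if "k = 2 \<or> k = 3"
    using that best_protocols_affine[OF expected_agreements_two]
      best_protocols_affine[OF expected_agreements_three] by auto
  moreover have "k \<ge> 2 \<or> k = 1"
    using assms(1) by linarith
  ultimately show ?thesis
    using best unfolding unique_best_up_to_perm_flip_def by auto
qed

end
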